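(* Let $Abs$ and $Ref$ be well-formed fair event systems, with disjoint tuples of state variables $var_{abs}$ and $var_{ref}$, and suppose $Ref$ is a refinement of $Abs$ with respect to the gluing invariant $J$ (all terms as defined in the context). Let $\sigma = s_0 s_1 \ldots$ be a run of $Ref$. Then there is a run $\tau = t_0 t_1 \ldots$ of $Abs$ such that, for every $i \in \mathbb{N}$, $J$ holds at the joint valuation of $var_{abs}$ and $var_{ref}$ given by $t_i$ and $s_i$.
   Context: A fair event system consists of: constant parameters constrained by a first-order constant assumption $Hyp$; a tuple $var$ of state variables; an initial condition $Init(var)$ (a state predicate); an invariant $Inv(var)$ (a state predicate); and a list of events. Each event $e$ with parameter list $x$ is given by a before-after predicate $BA_e(x,var,var')$ (a first-order formula over constants, $x$, unprimed variables = values before the transition, primed variables $var'$ = values after) and a fairness condition $fair_e(x,var)$ (a state predicate). The feasibility condition is $\mathbf{fis}\, e(x) := \exists var' : BA_e(x,var,var')$. The system is well-formed if $Hyp \models Init \Rightarrow Inv$; for every event $e$, $Hyp \models Inv(var) \land BA_e(x,var,var') \Rightarrow Inv(var')$; and for every event $e$, $Hyp \models Inv \land fair_e(x) \Rightarrow \mathbf{fis}\, e(x)$. A run is an $\omega$-sequence of states (valuations of the variables) $s_0 s_1\ldots$ such that $s_0$ satisfies $Init$; every pair $(s_i,s_{i+1})$ either satisfies $BA_e(x)$ for some event $e$ and some parameter values $x$, or agrees on all variables $var$ (stuttering step); and for every event $e$ and all parameter values $x$ there are infinitely many $i$ such that either $fair_e(x)$ is false at $s_i$ or $(s_i,s_{i+1})$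 satisfies $BA_e(x)$. Temporal formulas: for a run $\sigma$, $\sigma|_n$ denotes the suffix from position $n$; $\sigma|_n\models F$ for a state predicate $F$ means $F$ holds at $s_n$, and for an event formula $e(x)$ means $BA_e(x)$ holds of $(s_n,s_{n+1})$; this extends to Boolean combinations. $\sigma \models F \leadsto G$ iff for all $n$, if $\sigma|_n\models F$ then $\sigma|_m \models G$ for some $m\ge n$. A system satisfies a temporal formula if all its runs do. Refinement: $Ref$ (variables $var_{ref}$) refines $Abs$ (variables $var_{abs}$, disjoint from $var_{ref}$) with respect to a gluing invariant $J$ (a state predicate over $var_{abs}$, $var_{ref}$ and the constants of both systems, assumed to imply $Inv_{abs}$ and $Inv_{ref}$) when the following hold, where $Hyp$ is the conjunction of both constant assumptions. Each abstract event $ea(x)$ is refined by concrete events $er_1(x,y_1),\ldots,er_n(x,y_n)$ (whose parameters include those of $ea$); every other concrete event $en(z)$ is called new. Conditions: $Ref$ is well-formed; (i) $Hyp \models Init_{ref} \Rightarrow \exists var_{abs}: Init_{abs}\land J$; (ii) if $er(x,y)$ refines $ea(x)$ then $Hyp \models J \land BA_{er}(x,y) \Rightarrow \exists var_{abs}': BA_{ea}(x) \land J'$ (where $J'$ is $J$ with all variables primed); (iii) for every new event $en(z)$, $Hyp\models J \land BA_{en}(z) \Rightarrow \exists var_{abs}': var_{abs}'=var_{abs}\land J'$; (iv) for every abstract event $ea(x)$ refined by $er_1,\ldots,er_n$: $Ref \models (\exists var_{abs}: J\land fair_{ea}(x)) \leadsto ea_1(x)\lor\cdots\lor ea_n(x)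 \lor \lnot\exists var_{abs}: J\land fair_{ea}(x)$, where $ea_i(x) := \exists y_i: er_i(x,y_i) \land \forall var_{abs},var_{abs}': (J\land J' \Rightarrow BA_{ea}(x))$. *)

theory Defs
  imports Main
begin

text \<open>
  Formulas are represented by their semantics: the argument of type \<open>'c\<close> is an interpretation of
  the constants (those of all systems under consideration), and \<open>'v\<close> is the universe of values.
  Valuations of a finite tuple of variables or parameters are maps whose domain consists of
  exactly these names; \<open>t ++ s\<close> is the joint valuation when the domains are disjoint.
\<close>

definition valuations :: "'n set \<Rightarrow> ('n \<rightharpoonup> 'v) set" where
  "valuations N = {f. dom f = N}"

record ('c, 'x, 'p, 'v, 'e) event_system =
  hyp :: "'c \<Rightarrow> bool"
  vars :: "'x list"
  init :: "'c \<Rightarrow> ('x \<rightharpoonup> 'v) \<Rightarrow> bool"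
  invar :: "'c \<Rightarrow> ('x \<rightharpoonup> 'v) \<Rightarrow> bool"
  events :: "'e list"
  params :: "'e \<Rightarrow> 'p list"
  ba :: "'c \<Rightarrow> 'e \<Rightarrow> ('p \<rightharpoonup> 'v) \<Rightarrow> ('x \<rightharpoonup> 'v) \<Rightarrow> ('x \<rightharpoonup> 'v) \<Rightarrow> bool"
  fair :: "'c \<Rightarrow> 'e \<Rightarrow> ('p \<rightharpoonup> 'v) \<Rightarrow> ('x \<rightharpoonup> 'v) \<Rightarrow> bool"

definition states :: "('c, 'x, 'p, 'v, 'e) event_system \<Rightarrow> ('x \<rightharpoonup> 'v) set" where
  "states S = valuations (set (vars S))"

definition args :: "('c, 'x, 'p, 'v, 'e) event_system \<Rightarrow> 'e \<Rightarrow> ('p \<rightharpoonup> 'v) set" where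
  "args S e = valuations (set (params S e))"

definition fis ::
  "('c, 'x, 'p, 'v, 'e) event_system \<Rightarrow> 'c \<Rightarrow> 'e \<Rightarrow> ('p \<rightharpoonup> 'v) \<Rightarrow> ('x \<rightharpoonup> 'v) \<Rightarrow> bool" where
  "fis S c e x s \<longleftrightarrow> (\<exists>s' \<in> states S. ba S c e x s s')"

definition well_formed :: "('c, 'x, 'p, 'v, 'e) event_system \<Rightarrow> bool" where
  "well_formed S \<longleftrightarrow>
     (\<forall>c. hyp S c \<longrightarrow> (\<forall>s \<in> states S. init S c s \<longrightarrow> invar S c s)) \<and>
     (\<forall>e \<in> set (events S). \<forall>c. hyp S c \<longrightarrow>
        (\<forall>x \<in> args S e. \<forall>s \<in> states S. \<forall>s' \<in> states S.
           invar S c s \<and> ba S c e x s s' \<longrightarrow> invar S c s')) \<and>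
     (\<forall>e \<in> set (events S). \<forall>c. hyp S c \<longrightarrow>
        (\<forall>x \<in> args S e. \<forall>s \<in> states S.
           invar S c s \<and> fair S c e x s \<longrightarrow> fis S c e x s))"

text \<open>
  The interpretation of the constants is fixed along a run. That it satisfies the constant
  assumption is not part of the following definition but is required wherever runs are used.
\<close>

definition run ::
  "('c, 'x, 'p, 'v, 'e) event_system \<Rightarrow> 'c \<Rightarrow> (nat \<Rightarrow> ('x \<rightharpoonup> 'v)) \<Rightarrow> bool" where
  "run S c \<sigma> \<longleftrightarrow>
     (\<forall>i. \<sigma> i \<in> states S) \<and>
     init S c (\<sigma> 0) \<and>
     (\<forall>i. (\<exists>e \<in> set (events S). \<exists>x \<in> args S e. ba S c e x (\<sigma> i) (\<sigma> (Suc i))) \<or>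
          (\<forall>v \<in> set (vars S). \<sigma> (Suc i) v = \<sigma> i v)) \<and>
     (\<forall>e \<in> set (events S). \<forall>x \<in> args S e.
        \<exists>\<^sub>\<infinity>i. \<not> fair S c e x (\<sigma> i) \<or> ba S c e x (\<sigma> i) (\<sigma> (Suc i)))"

text \<open>Temporal formulas are predicates on \<open>\<omega>\<close>-sequences of states.\<close>

definition suffix :: "(nat \<Rightarrow> 's) \<Rightarrow> nat \<Rightarrow> (nat \<Rightarrow> 's)" where
  "suffix \<sigma> n = (\<lambda>i. \<sigma> (n + i))"

definition state_formula :: "('s \<Rightarrow> bool) \<Rightarrow> (nat \<Rightarrow> 's) \<Rightarrow> bool" where
  "state_formula P \<sigma> \<longleftrightarrow> P (\<sigma> 0)"

definition step_formula :: "('s \<Rightarrow> 's \<Rightarrow> bool) \<Rightarrow> (nat \<Rightarrow> 's) \<Rightarrow> bool" where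
  "step_formula P \<sigma> \<longleftrightarrow> P (\<sigma> 0) (\<sigma> 1)"

definition leads_to ::
  "((nat \<Rightarrow> 's) \<Rightarrow> bool) \<Rightarrow> ((nat \<Rightarrow> 's) \<Rightarrow> bool) \<Rightarrow> (nat \<Rightarrow> 's) \<Rightarrow> bool" where
  "leads_to F G \<sigma> \<longleftrightarrow> (\<forall>n. F (suffix \<sigma> n) \<longrightarrow> (\<exists>m \<ge> n. G (suffix \<sigma> m)))"

definition satisfies ::
  "('c \<Rightarrow> bool) \<Rightarrow> ('c, 'x, 'p, 'v, 'e) event_system \<Rightarrow>
   ('c \<Rightarrow> (nat \<Rightarrow> ('x \<rightharpoonup> 'v)) \<Rightarrow> bool) \<Rightarrow> bool" where
  "satisfies H S F \<longleftrightarrow> (\<forall>c. H c \<longrightarrow> (\<forall>\<sigma>. run S c \<sigma> \<longrightarrow> F c \<sigma>))"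

definition abs_fair ::
  "('c, 'x, 'p, 'v, 'ea) event_system \<Rightarrow> ('c \<Rightarrow> ('x \<rightharpoonup> 'v) \<Rightarrow> bool) \<Rightarrow>
   'c \<Rightarrow> 'ea \<Rightarrow> ('p \<rightharpoonup> 'v) \<Rightarrow> ('x \<rightharpoonup> 'v) \<Rightarrow> bool" where
  "abs_fair Abs J c ea x s \<longleftrightarrow> (\<exists>t \<in> states Abs. J c (t ++ s) \<and> fair Abs c ea x t)"

text \<open>
  The values of the parameters that \<open>er\<close> has in addition to those of \<open>ea\<close>; thus \<open>er(x,y)\<close> is the
  event \<open>er\<close> at \<open>x ++ y\<close>, with \<open>x \<in> args Abs ea\<close> and \<open>y \<in> extra_args Abs ea Ref er\<close>.
\<close>

definition extra_args ::
  "('c, 'x, 'p, 'v, 'ea) event_system \<Rightarrow> 'ea \<Rightarrow> ('c, 'x, 'p, 'v, 'er) event_system \<Rightarrow> 'er \<Rightarrow>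
   ('p \<rightharpoonup> 'v) set" where
  "extra_args Abs ea Ref er = valuations (set (params Ref er) - set (params Abs ea))"

text \<open>
  The formula \<open>ea\<^sub>i(x)\<close>, that is,
  \<open>\<exists>y. er(x,y) \<and> (\<forall>var\<^sub>a\<^sub>b\<^sub>s var\<^sub>a\<^sub>b\<^sub>s'. J \<and> J' \<Rightarrow> BA\<^sub>e\<^sub>a(x))\<close>, for the concrete event \<open>er\<close>.
\<close>

definition forcing_step ::
  "('c, 'x, 'p, 'v, 'ea) event_system \<Rightarrow> ('c, 'x, 'p, 'v, 'er) event_system \<Rightarrow>
   ('c \<Rightarrow> ('x \<rightharpoonup> 'v) \<Rightarrow> bool) \<Rightarrow> 'c \<Rightarrow> 'ea \<Rightarrow> 'er \<Rightarrow> ('p \<rightharpoonup> 'v) \<Rightarrow>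
   ('x \<rightharpoonup> 'v) \<Rightarrow> ('x \<rightharpoonup> 'v) \<Rightarrow> bool" where
  "forcing_step Abs Ref J c ea er x s s' \<longleftrightarrow>
     (\<exists>y \<in> extra_args Abs ea Ref er. ba Ref c er (x ++ y) s s' \<and>
        (\<forall>t \<in> states Abs. \<forall>t' \<in> states Abs.
           J c (t ++ s) \<and> J c (t' ++ s') \<longrightarrow> ba Abs c ea x t t'))"

text \<open>
  \<open>(ea, er) \<in> R\<close> means that the concrete event \<open>er\<close> is one of those refining the abstract event
  \<open>ea\<close>; the concrete events outside \<open>Range R\<close> are the new ones.
\<close>

definition refinement ::
  "('c, 'x, 'p, 'v, 'ea) event_system \<Rightarrow> ('c, 'x, 'p, 'v, 'er) event_system \<Rightarrow>
   ('ea \<times> 'er) set \<Rightarrow> ('c \<Rightarrow> ('x \<rightharpoonup> 'v) \<Rightarrow> bool) \<Rightarrow> bool" where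
  "refinement Abs Ref R J \<longleftrightarrow>
     (let Hyp = (\<lambda>c. hyp Abs c \<and> hyp Ref c) in
       set (vars Abs) \<inter> set (vars Ref) = {} \<and>
       (\<forall>c. Hyp c \<longrightarrow> (\<forall>t \<in> states Abs. \<forall>s \<in> states Ref.
          J c (t ++ s) \<longrightarrow> invar Abs c t \<and> invar Ref c s)) \<and>
       R \<subseteq> set (events Abs) \<times> set (events Ref) \<and>
       (\<forall>(ea, er) \<in> R. set (params Abs ea) \<subseteq> set (params Ref er)) \<and>
       well_formed Ref \<and>
       (\<forall>c. Hyp c \<longrightarrow> (\<forall>s \<in> states Ref.
          init Ref c s \<longrightarrow> (\<exists>t \<in> states Abs. init Abs c t \<and> J c (t ++ s)))) \<and>
       (\<forall>(ea, er) \<in> R. \<forall>c. Hyp c \<longrightarrow>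
          (\<forall>x \<in> args Abs ea. \<forall>y \<in> extra_args Abs ea Ref er.
           \<forall>t \<in> states Abs. \<forall>s \<in> states Ref. \<forall>s' \<in> states Ref.
             J c (t ++ s) \<and> ba Ref c er (x ++ y) s s' \<longrightarrow>
             (\<exists>t' \<in> states Abs. ba Abs c ea x t t' \<and> J c (t' ++ s')))) \<and>
       (\<forall>en \<in> set (events Ref) - Range R. \<forall>c. Hyp c \<longrightarrow>
          (\<forall>z \<in> args Ref en.
           \<forall>t \<in> states Abs. \<forall>s \<in> states Ref. \<forall>s' \<in> states Ref.
             J c (t ++ s) \<and> ba Ref c en z s s' \<longrightarrow>
             (\<exists>t' \<in> states Abs. t' = t \<and> J c (t' ++ s')))) \<and>
       (\<forall>ea \<in> set (events Abs). \<forall>x \<in> args Abs ea.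
          satisfies Hyp Ref (\<lambda>c. leads_to
            (state_formula (abs_fair Abs J c ea x))
            (\<lambda>\<rho>. (\<exists>er. (ea, er) \<in> R \<and> step_formula (forcing_step Abs Ref J c ea er x) \<rho>) \<or>
                 \<not> state_formula (abs_fair Abs J c ea x) \<rho>))))"

end

theory Submission
  imports Defs "HOL-Library.Infinite_Set"
begin

text \<open>
  Conditions (i)--(iii) yield, step by step, some abstract sequence that stays glued to \<open>\<sigma>\<close>.
  Every such sequence is fair, whichever choices were made: if \<open>ea(x)\<close> is fair at \<open>\<tau>\<^sub>n\<close>, then
  \<open>\<sigma>\<^sub>n\<close> satisfies the left-hand side of condition (iv), which gives a later position \<open>m\<close>. There
  either no abstract state glued to \<open>\<sigma>\<^sub>m\<close>, in particular not \<open>\<tau>\<^sub>m\<close>, is fair for \<open>ea(x)\<close>, or the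
  step of \<open>\<sigma>\<close> forces every glued abstract step, in particular that of \<open>\<tau>\<close>, to be a step of
  \<open>ea(x)\<close>.
\<close>

text \<open>Isolates the step clause of \<open>run\<close>, so that simulating one step can be
  stated for both systems and then iterated.\<close>

definition next_step ::
  "('c, 'x, 'p, 'v, 'e) event_system \<Rightarrow> 'c \<Rightarrow> ('x \<rightharpoonup> 'v) \<Rightarrow> ('x \<rightharpoonup> 'v) \<Rightarrow> bool" where
  "next_step S c s s' \<longleftrightarrow>
     (\<exists>e \<in> set (events S). \<exists>x \<in> args S e. ba S c e x s s') \<or> (\<forall>v \<in> set (vars S). s' v = s v)"

text \<open>Outside the listed variables both maps are \<open>None\<close>. Stuttering is only
  agreement on the variables, while \<open>J\<close> reads the whole map; this bridges the
  two.\<close>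

lemma states_eqI:
  assumes "s \<in> states S" "s' \<in> states S" "\<forall>v \<in> set (vars S). s' v = s v"
  shows "s' = s"
proof
  fix v
  show "s' v = s v"
    using assms unfolding states_def valuations_def
    by (cases "v \<in> set (vars S)") (auto, metis domIff)
qed

text \<open>A run supplies one valuation \<open>z\<close> of all parameters of \<open>er\<close>,
  whereas condition (ii) speaks of \<open>x ++ y\<close>. Restricting \<open>z\<close> to the
  parameters of \<open>ea\<close> and to their complement gives the two parts.\<close>

lemma args_split:
  assumes "z \<in> args Ref er" "set (params Abs ea) \<subseteq> set (params Ref er)"
  obtains x y where "x \<in> args Abs ea" "y \<in> extra_args Abs ea Ref er" "z = x ++ y"
proof
  let ?P = "set (params Abs ea)"
  show "z |` ?P \<in> args Abs ea" "z |` (- ?P) \<in> extra_args Abs ea Ref er"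
    using assms by (auto simp: args_def extra_args_def valuations_def)
  show "z = z |` ?P ++ z |` (- ?P)"
    by (auto simp: fun_eq_iff map_add_def restrict_map_def split: option.split)
qed

text \<open>The abstract answer depends on the concrete step: condition (ii) answers a refining
  event by an abstract event, condition (iii) answers a new event by stuttering, and stuttering is
  answered by stuttering.\<close>

lemma refinement_step:
  assumes ref: "refinement Abs Ref R J" and hyp: "hyp Abs c" "hyp Ref c"
    and st: "t \<in> states Abs" "s \<in> states Ref" "s' \<in> states Ref"
    and glue: "J c (t ++ s)" and step: "next_step Ref c s s'"
  shows "\<exists>t' \<in> states Abs. J c (t' ++ s') \<and> next_step Abs c t t'"
  using step unfolding next_step_def[of Ref]
proof (elim disjE bexE)
  fix er z
  assume er: "er \<in> set (events Ref)" "z \<in> args Ref er" "ba Ref c er z s s'"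
  show ?thesis
  proof (cases "er \<in> Range R")
    case True
    \<comment> \<open>\<open>er\<close> may refine several abstract events; any one of them will
      do.\<close>
    then obtain ea where ea: "(ea, er) \<in> R" by blast
    have "\<forall>(ea, er) \<in> R. set (params Abs ea) \<subseteq> set (params Ref er)"
      using ref unfolding refinement_def Let_def by (elim conjE)
    with ea have sub: "set (params Abs ea) \<subseteq> set (params Ref er)"
      by auto
    have "R \<subseteq> set (events Abs) \<times> set (events Ref)"
      using ref unfolding refinement_def Let_def by (elim conjE)
    with ea have in_ev: "ea \<in> set (events Abs)"
      by auto
    obtain x y where xy: "x \<in> args Abs ea" "y \<in> extra_args Abs ea Ref er" "z = x ++ y"
      using args_split[OF er(2) sub] .
    have "\<forall>(ea, er) \<in> R. \<forall>c. hyp Abs c \<and> hyp Ref c \<longrightarrow>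
          (\<forall>x \<in> args Abs ea. \<forall>y \<in> extra_args Abs ea Ref er.
           \<forall>t \<in> states Abs. \<forall>s \<in> states Ref. \<forall>s' \<in> states Ref.
             J c (t ++ s) \<and> ba Ref c er (x ++ y) s s' \<longrightarrow>
             (\<exists>t' \<in> states Abs. ba Abs c ea x t t' \<and> J c (t' ++ s')))"
      using ref unfolding refinement_def Let_def by (elim conjE)
    from bspec[OF this ea, unfolded prod.case, rule_format, OF conjI[OF hyp] xy(1,2) st
        conjI[OF glue er(3)[unfolded xy(3)]]]
    show ?thesis
      using in_ev xy(1) unfolding next_step_def by blast
  next
    case False
    have "\<forall>en \<in> set (events Ref) - Range R. \<forall>c. hyp Abs c \<and> hyp Ref c \<longrightarrow>
          (\<forall>z \<in> args Ref en.
           \<forall>t \<in> states Abs. \<forall>s \<in> states Ref. \<forall>s' \<in> states Ref.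
             J c (t ++ s) \<and> ba Ref c en z s s' \<longrightarrow>
             (\<exists>t' \<in> states Abs. t' = t \<and> J c (t' ++ s')))"
      using ref unfolding refinement_def Let_def by (elim conjE)
    from this[rule_format, OF DiffI[OF er(1) False] conjI[OF hyp] er(2) st conjI[OF glue er(3)]]
    show ?thesis
      using st(1) unfolding next_step_def by blast
  qed
next
  assume "\<forall>v \<in> set (vars Ref). s' v = s v"
  then have "s' = s" using states_eqI st by blast
  then show ?thesis
    using st(1) glue unfolding next_step_def by blast
qed

lemma glued_sequence_fair:
  assumes ref: "refinement Abs Ref R J" and hyp: "hyp Abs c" "hyp Ref c"
    and run: "run Ref c \<sigma>"
    and st: "\<And>i. \<tau> i \<in> states Abs" and glue: "\<And>i. J c (\<tau> i ++ \<sigma> i)"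
    and ea: "ea \<in> set (events Abs)" "x \<in> args Abs ea"
  shows "\<exists>\<^sub>\<infinity>i. \<not> fair Abs c ea x (\<tau> i) \<or> ba Abs c ea x (\<tau> i) (\<tau> (Suc i))"
  \<comment> \<open>"Infinitely often" becomes "for every \<open>n\<close>, at some
    \<open>m \<ge> n\<close>", the shape that \<open>leads_to\<close> provides.\<close>
  unfolding INFM_nat_le
proof
  fix n
  have lead: "leads_to (state_formula (abs_fair Abs J c ea x))
     (\<lambda>\<rho>. (\<exists>er. (ea, er) \<in> R \<and> step_formula (forcing_step Abs Ref J c ea er x) \<rho>) \<or>
          \<not> state_formula (abs_fair Abs J c ea x) \<rho>) \<sigma>"
  proof -
    have "\<forall>ea \<in> set (events Abs). \<forall>x \<in> args Abs ea.
          satisfies (\<lambda>c. hyp Abs c \<and> hyp Ref c) Ref (\<lambda>c. leads_to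
            (state_formula (abs_fair Abs J c ea x))
            (\<lambda>\<rho>. (\<exists>er. (ea, er) \<in> R \<and> step_formula (forcing_step Abs Ref J c ea er x) \<rho>) \<or>
                 \<not> state_formula (abs_fair Abs J c ea x) \<rho>))"
      using ref unfolding refinement_def Let_def by (elim conjE)
    then show ?thesis
      using hyp run ea by (simp add: satisfies_def)
  qed
  show "\<exists>m\<ge>n. \<not> fair Abs c ea x (\<tau> m) \<or> ba Abs c ea x (\<tau> m) (\<tau> (Suc m))"
  proof (cases "fair Abs c ea x (\<tau> n)")
    case True
    \<comment> \<open>The witness for the hidden abstract state is \<open>\<tau> n\<close>
      itself.\<close>
    then have "abs_fair Abs J c ea x (\<sigma> n)"
      using st glue unfolding abs_fair_def by blast
    then obtain m where "m \<ge> n" and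
      "(\<exists>er. forcing_step Abs Ref J c ea er x (\<sigma> m) (\<sigma> (Suc m))) \<or> \<not> abs_fair Abs J c ea x (\<sigma> m)"
      using lead unfolding leads_to_def state_formula_def step_formula_def suffix_def by simp blast
    then show ?thesis
      using st glue unfolding forcing_step_def abs_fair_def by blast
  \<comment> \<open>If \<open>ea\<close> is not fair at \<open>\<tau> n\<close>, then
    \<open>m = n\<close> serves.\<close>
  qed blast
qed

theorem theorem1:
  fixes Abs :: "('c, 'x, 'p, 'v, 'ea) event_system"
    and Ref :: "('c, 'x, 'p, 'v, 'er) event_system"
    and R :: "('ea \<times> 'er) set"
    and J :: "'c \<Rightarrow> ('x \<rightharpoonup> 'v) \<Rightarrow> bool"
    and c :: 'c
    and \<sigma> :: "nat \<Rightarrow> ('x \<rightharpoonup> 'v)"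
  assumes "well_formed Abs"
    and "well_formed Ref"
    and "set (vars Abs) \<inter> set (vars Ref) = {}"
    and "refinement Abs Ref R J"
    and "hyp Abs c"
    and "hyp Ref c"
    and "run Ref c \<sigma>"
  shows "\<exists>\<tau>. run Abs c \<tau> \<and> (\<forall>i. J c (\<tau> i ++ \<sigma> i))"
proof -
  have st: "\<sigma> i \<in> states Ref" and step: "next_step Ref c (\<sigma> i) (\<sigma> (Suc i))" for i
    using assms(7) unfolding run_def next_step_def by blast+
  \<comment> \<open>The guarded last conjunct makes the choice principle start in an initial state;
    at later positions it is vacuous.\<close>
  let ?P = "\<lambda>i t. t \<in> states Abs \<and> J c (t ++ \<sigma> i) \<and> (i = 0 \<longrightarrow> init Abs c t)"
  have "\<exists>\<tau>. \<forall>i. ?P i (\<tau> i) \<and> next_step Abs c (\<tau> i) (\<tau> (Suc i))"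
  \<comment> \<open>Each abstract state must be chosen depending on the previous one, since
    \<open>J\<close> may relate many abstract states to a concrete one.\<close>
  proof (rule dependent_nat_choice)
    have "init Ref c (\<sigma> 0)"
      using assms(7) unfolding run_def by blast
    moreover have "\<forall>c. hyp Abs c \<and> hyp Ref c \<longrightarrow> (\<forall>s \<in> states Ref.
          init Ref c s \<longrightarrow> (\<exists>t \<in> states Abs. init Abs c t \<and> J c (t ++ s)))"
      using assms(4) unfolding refinement_def Let_def by (elim conjE)
    ultimately show "\<exists>t. ?P 0 t"
      using assms(5,6) st[of 0] by auto
  next
    fix t i
    assume "?P i t"
    then have "\<exists>t' \<in> states Abs. J c (t' ++ \<sigma> (Suc i)) \<and> next_step Abs c t t'"
      by (intro refinement_step[OF assms(4-6) _ st st _ step]) simp_all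
    then show "\<exists>t'. ?P (Suc i) t' \<and> next_step Abs c t t'"
      by auto
  qed
  then obtain \<tau> where \<tau>: "\<And>i. ?P i (\<tau> i)" "\<And>i. next_step Abs c (\<tau> i) (\<tau> (Suc i))"
    by blast
  then have st': "\<And>i. \<tau> i \<in> states Abs" and glue: "\<And>i. J c (\<tau> i ++ \<sigma> i)" and init: "init Abs c (\<tau> 0)"
    by simp_all
  have "run Abs c \<tau>"
    unfolding run_def
    using st' init \<tau>(2) glued_sequence_fair[OF assms(4-7) st' glue]
    by (simp add: next_step_def)
  with glue show ?thesis by blast
qed

end
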